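(* There is no non-zero symmetric continuous linear functional on $\ell_\infty$; that is, if $\gamma:\ell_\infty\to\mathbb{K}$ is a continuous linear functional with $\gamma(x_\sigma)=\gamma(x)$ for every $x\in\ell_\infty$ and every permutation $\sigma$ of $\mathbb{N}$, then $\gamma=0$.
   Context: $\mathbb{K}=\mathbb{R}$ or $\mathbb{C}$; $\ell_\infty$ is the space of bounded sequences in $\mathbb{K}^{\mathbb{N}}$ with the supremum norm. For a sequence $x=(x_n)_n$ and a permutation (bijection) $\sigma$ of $\mathbb{N}$, $x_\sigma=(x_{\sigma(n)})_n$. A functional $\gamma$ is called symmetric if $\gamma(x)=\gamma(x_\sigma)$ for every $x$ and every permutation $\sigma$ of $\mathbb{N}$. *)

theory Defs
  imports "HOL-Analysis.Analysis"
begin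

text \<open>
  Every function on the discrete space \<^typ>\<open>nat\<close> is continuous, so the bounded continuous functions
  on it are exactly the bounded sequences; their library norm is the supremum norm.
\<close>

type_synonym 'k linf = "nat \<Rightarrow>\<^sub>C 'k"

lemma bcontfun_nat_iff:
  "(f :: nat \<Rightarrow> 'k::metric_space) \<in> bcontfun \<longleftrightarrow> bounded (range f)"
  by (simp add: bcontfun_def continuous_on_discrete)

text \<open>
  The library provides only real scalar multiplication on this type, whereas linearity of a
  functional is meant over the field of scalars itself.
\<close>

definition linf_scale :: "'k::real_normed_field \<Rightarrow> 'k linf \<Rightarrow> 'k linf" where
  "linf_scale c x = Bcontfun (\<lambda>n. c * apply_bcontfun x n)"

definition linf_permute :: "(nat \<Rightarrow> nat) \<Rightarrow> 'k::real_normed_field linf \<Rightarrow> 'k linf" where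
  "linf_permute \<sigma> x = Bcontfun (\<lambda>n. apply_bcontfun x (\<sigma> n))"

lemma apply_linf_scale [simp]: "apply_bcontfun (linf_scale c x) n = c * apply_bcontfun x n"
proof -
  have "bounded ((\<lambda>y. c * y) ` range (apply_bcontfun x))"
    by (intro bounded_linear_image bounded_linear_mult_right) simp
  then have "(\<lambda>n. c * apply_bcontfun x n) \<in> bcontfun"
    by (simp add: bcontfun_nat_iff image_image)
  then show ?thesis
    by (simp add: linf_scale_def Bcontfun_inverse)
qed

lemma apply_linf_permute [simp]: "apply_bcontfun (linf_permute \<sigma> x) n = apply_bcontfun x (\<sigma> n)"
proof -
  have "bounded (range (\<lambda>n. apply_bcontfun x (\<sigma> n)))"
    by (rule bounded_subset [of "range (apply_bcontfun x)"]) auto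
  then show ?thesis
    by (simp add: linf_permute_def bcontfun_nat_iff Bcontfun_inverse)
qed

lemma norm_linf: "norm (x :: 'k::real_normed_field linf) = (SUP n. norm (apply_bcontfun x n))"
  by (simp add: norm_bcontfun_def dist_bcontfun_def)

lemma vector_space_linf: "vector_space (linf_scale :: 'k::real_normed_field \<Rightarrow> _)"
  by unfold_locales (auto intro!: bcontfun_eqI simp: algebra_simps)

definition continuous_linear_functional :: "('k::real_normed_field linf \<Rightarrow> 'k) \<Rightarrow> bool" where
  "continuous_linear_functional \<gamma> \<longleftrightarrow>
     Vector_Spaces.linear linf_scale (*) \<gamma> \<and> continuous_on UNIV \<gamma>"

definition symmetric_functional :: "('k::real_normed_field linf \<Rightarrow> 'k) \<Rightarrow> bool" where
  "symmetric_functional \<gamma> \<longleftrightarrow> (\<forall>x \<sigma>. bij \<sigma> \<longrightarrow> \<gamma> (linf_permute \<sigma> x) = \<gamma> x)"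

lemma continuous_linear_functional_iff:
  "continuous_linear_functional \<gamma> \<longleftrightarrow>
     (\<forall>x y. \<gamma> (x + y) = \<gamma> x + \<gamma> y) \<and> (\<forall>c x. \<gamma> (linf_scale c x) = c * \<gamma> x) \<and> continuous_on UNIV \<gamma>"
proof -
  have "vector_space ((*) :: 'a \<Rightarrow> 'a \<Rightarrow> 'a)"
    by unfold_locales (auto simp: algebra_simps)
  then show ?thesis
    unfolding continuous_linear_functional_def
      Vector_Spaces.linear_iff
    using vector_space_linf by blast
qed

end

theory Submission
  imports Defs
begin

text \<open>
  A symmetric additive functional kills every difference of a sequence and one of its
  rearrangements, so it is enough to write each bounded sequence as a finite sum of such
  differences.  This is possible by a telescoping trick when a sequence \<open>x\<close> is supported on a set
  \<open>A\<close> that is infinite and has infinite complement.  Arrange the index set as a grid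
  \<open>\<int> \<times> \<nat>\<close> whose row \<open>0\<close> is \<open>A\<close>, and let \<open>y\<close> repeat \<open>x\<close> on all rows of non-negative index and
  vanish on the others.  The shift of rows by one moves \<open>y\<close> to the same sequence started at
  row \<open>1\<close>, so the difference of the two is \<open>x\<close> (\<open>coinfinite_support_eq_difference\<close>).
  The rows are indexed by the integers, because the shift then permutes the whole grid.
  Finally, every bounded sequence is the sum of its restrictions to the even and the odd
  indices, and both of these have a support of the required kind.
\<close>

lemma ex_linf_gated_reindex:
  fixes x :: "'k::real_normed_field linf"
  shows "\<exists>y :: 'k linf. \<forall>n. apply_bcontfun y n = (if P n then apply_bcontfun x (h n) else 0)"
proof -
  let ?f = "\<lambda>n. if P n then apply_bcontfun x (h n) else 0"
  have "bounded (insert 0 (range (apply_bcontfun x)))"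
    by simp
  then have "bounded (range ?f)"
    by (rule bounded_subset) auto
  then have "?f \<in> bcontfun"
    by (simp add: bcontfun_nat_iff)
  then have "\<forall>n. apply_bcontfun (Bcontfun ?f) n = ?f n"
    by (simp add: Bcontfun_inverse)
  then show ?thesis ..
qed

lemma countably_infinite_bij_betw:
  assumes "countable A" "infinite A" "countable B" "infinite B"
  shows "\<exists>f. bij_betw f A B"
  using bij_betw_trans[OF to_nat_on_infinite bij_betw_from_nat_into] assms by blast

text \<open>
  Any infinite set with infinite complement can play the part of the row with index \<open>0\<close>, since
  both this row and the rest of the grid are countably infinite.
\<close>

lemma ex_grid_with_zero_row:
  fixes A :: "nat set"
  assumes "infinite A" "infinite (- A)"
  shows "\<exists>g :: nat \<Rightarrow> int \<times> nat. bij g \<and> (\<forall>n. fst (g n) = 0 \<longleftrightarrow> n \<in> A)"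
proof -
  let ?R = "{0::int} \<times> (UNIV :: nat set)"
  have "infinite ?R"
    by (simp add: finite_cartesian_product_iff)
  then obtain g1 where g1: "bij_betw g1 A ?R"
    using assms(1) countably_infinite_bij_betw[of A ?R] by auto
  have "infinite ({1::int} \<times> (UNIV :: nat set))"
    by (simp add: finite_cartesian_product_iff)
  moreover have "{1::int} \<times> (UNIV :: nat set) \<subseteq> - ?R"
    by auto
  ultimately have "infinite (- ?R)"
    using infinite_super by blast
  then obtain g2 where g2: "bij_betw g2 (- A) (- ?R)"
    using assms(2) countably_infinite_bij_betw[of "- A" "- ?R"] by auto
  let ?g = "\<lambda>n. if n \<in> A then g1 n else g2 n"
  have "bij_betw ?g (A \<union> - A) (?R \<union> - ?R)"
    by (intro bij_betw_disjoint_Un g1 g2) auto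
  then have "bij ?g"
    by (simp only: Compl_partition)
  moreover have "fst (?g n) = 0 \<longleftrightarrow> n \<in> A" for n
    using bij_betw_apply[OF g1, of n] bij_betw_apply[OF g2, of n] by (cases "g2 n") auto
  ultimately show ?thesis
    by blast
qed

text \<open>
  Telescoping along the rows of the grid: \<open>y\<close> is the sum of the copies of \<open>x\<close> in the rows
  \<open>0, 1, 2, \<dots>\<close>, and its shift is the sum of the copies in the rows \<open>1, 2, \<dots>\<close>.  The rows are
  disjoint, so \<open>y\<close> takes no values other than those of \<open>x\<close> and \<open>0\<close>, and is bounded.
\<close>

lemma coinfinite_support_eq_difference:
  fixes x :: "'k::real_normed_field linf"
  assumes "infinite A" "infinite (- A)"
    and supp: "\<And>n. n \<notin> A \<Longrightarrow> apply_bcontfun x n = 0"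
  shows "\<exists>y \<sigma>. bij \<sigma> \<and> x = y - linf_permute \<sigma> y"
proof -
  obtain g :: "nat \<Rightarrow> int \<times> nat"
    where g: "bij g" and row0: "\<And>n. fst (g n) = 0 \<longleftrightarrow> n \<in> A"
    using ex_grid_with_zero_row[OF assms(1,2)] by blast
  have inv_g: "inv g (g n) = n" and g_inv: "g (inv g p) = p" for n p
    using g by (simp_all add: bij_is_inj bij_is_surj surj_f_inv_f)
  let ?shift = "\<lambda>p :: int \<times> nat. (fst p - 1, snd p)"
  have shift: "bij ?shift"
    by (rule o_bij[where g = "\<lambda>p. (fst p + 1, snd p)"]) (auto simp: fun_eq_iff)
  define \<sigma> where "\<sigma> = inv g \<circ> ?shift \<circ> g"
  have "bij \<sigma>"
    unfolding \<sigma>_def by (intro bij_comp g shift bij_imp_bij_inv)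
  obtain y :: "'k linf" where y: "\<And>n. apply_bcontfun y n =
      (if fst (g n) \<ge> 0 then apply_bcontfun x (inv g (0, snd (g n))) else 0)"
    using ex_linf_gated_reindex[of "\<lambda>n. fst (g n) \<ge> 0" x "\<lambda>n. inv g (0, snd (g n))"] by blast
  have "apply_bcontfun x n = apply_bcontfun (y - linf_permute \<sigma> y) n" for n
  proof (cases "n \<in> A")
    case True
    then have "fst (g n) = 0"
      using row0 by simp
    moreover from this have "inv g (0, snd (g n)) = n"
      by (metis inv_g prod.collapse)
    ultimately show ?thesis
      by (simp add: minus_bcontfun.rep_eq y \<sigma>_def g_inv)
  next
    case False
    then have "fst (g n) \<noteq> 0"
      using row0 by simp
    \<comment> \<open>Away from row 0 the index of the row of \<open>n\<close> and its predecessor are both non-negative or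
      both negative, so \<open>y\<close> has the same value at \<open>n\<close> and at \<open>\<sigma> n\<close>.\<close>
    then have "fst (g n) \<ge> 0 \<longleftrightarrow> fst (g n) - 1 \<ge> 0"
      by linarith
    then show ?thesis
      by (simp add: minus_bcontfun.rep_eq y \<sigma>_def g_inv supp[OF False])
  qed
  then have "x = y - linf_permute \<sigma> y"
    by (intro bcontfun_eqI)
  with \<open>bij \<sigma>\<close> show ?thesis
    by blast
qed

lemma symmetric_additive_vanishes:
  fixes \<gamma> :: "'k::real_normed_field linf \<Rightarrow> 'k"
  assumes "Modules.additive \<gamma>" and sym: "symmetric_functional \<gamma>"
  shows "\<gamma> x = 0"
proof -
  interpret Modules.additive \<gamma> by fact
  have vanish: "\<gamma> z = 0" if supp: "infinite A" "infinite (- A)"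
    "\<And>n. n \<notin> A \<Longrightarrow> apply_bcontfun z n = 0" for z A
  proof -
    obtain y \<sigma> where "bij \<sigma>" and z: "z = y - linf_permute \<sigma> y"
      using coinfinite_support_eq_difference[OF supp] by blast
    have "\<gamma> z = \<gamma> y - \<gamma> (linf_permute \<sigma> y)"
      by (simp add: z diff)
    also have "\<dots> = 0"
      using sym \<open>bij \<sigma>\<close> by (simp add: symmetric_functional_def)
    finally show ?thesis .
  qed
  let ?E = "{n :: nat. even n}"
  have "infinite ?E"
    unfolding infinite_nat_iff_unbounded_le
    by (metis mem_Collect_eq dvd_triv_left le_add1 mult_2)
  have "infinite (- ?E)"
    unfolding infinite_nat_iff_unbounded_le
    by (metis ComplI mem_Collect_eq even_Suc dvd_triv_left le_SucI le_add1 mult_2)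
  obtain u :: "'k linf"
    where u: "\<And>n. apply_bcontfun u n = (if even n then apply_bcontfun x n else 0)"
    using ex_linf_gated_reindex[of even x "\<lambda>n. n"] by blast
  have "\<gamma> u = 0"
    by (rule vanish[of ?E]) (use \<open>infinite ?E\<close> \<open>infinite (- ?E)\<close> u in auto)
  moreover have "\<gamma> (x - u) = 0"
    by (rule vanish[of "- ?E"])
      (use \<open>infinite ?E\<close> \<open>infinite (- ?E)\<close> u in \<open>auto simp: minus_bcontfun.rep_eq\<close>)
  ultimately show ?thesis
    by (simp add: diff)
qed

theorem proposition1p4:
  shows "(\<forall>\<gamma> :: real linf \<Rightarrow> real.
            continuous_linear_functional \<gamma> \<and> symmetric_functional \<gamma> \<longrightarrow> \<gamma> = (\<lambda>x. 0)) \<and>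
         (\<forall>\<gamma> :: complex linf \<Rightarrow> complex.
            continuous_linear_functional \<gamma> \<and> symmetric_functional \<gamma> \<longrightarrow> \<gamma> = (\<lambda>x. 0))"
  by (auto simp: continuous_linear_functional_iff Modules.additive_def fun_eq_iff
      intro!: symmetric_additive_vanishes)

end
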